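(* Let $\Gamma$ be a finite abelian group and let $S\subseteq\Gamma$ with $0\notin S$. Then the mixed Cayley graph $\mathrm{Cay}(\Gamma,S)$ is Eisenstein integral if and only if it is HS-integral.
   Context: $\Gamma$ is written additively. The mixed Cayley graph $\mathrm{Cay}(\Gamma,S)$ has vertex set $\Gamma$ and arc set $\{(a,b): b-a\in S\}$. Its $(0,1)$-adjacency matrix $\mathcal{A}=(a_{uv})$ has $a_{uv}=1$ if $(u,v)$ is an arc and $a_{uv}=0$ otherwise. A mixed graph is Eisenstein integral if all eigenvalues of $\mathcal{A}$ are Eisenstein integers, i.e. numbers of the form $a+b\omega_3$ with $a,b\in\mathbb{Z}$ and $\omega_3=\frac{-1+i\sqrt3}{2}$. The Hermitian adjacency matrix of second kind $\mathcal{H}=(h_{uv})$ is defined by $h_{uv}=1$ if both $(u,v)$ and $(v,u)$ are arcs, $h_{uv}=\frac{1+i\sqrt3}{2}$ if only $(u,v)$ is an arc, $h_{uv}=\frac{1-i\sqrt3}{2}$ if only $(v,u)$ is an arc, and $h_{uv}=0$ otherwise. The graph is HS-integral if all eigenvalues of $\mathcal{H}$ are integers. *)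

theory Defs
  imports "HOL-Analysis.Analysis"
begin

text \<open>A mixed graph whose vertex set is the whole (finite) type is given by its set of arcs;
  an undirected edge is a pair of opposite arcs.\<close>

definition cayley_arcs :: "'a::ab_group_add set \<Rightarrow> ('a \<times> 'a) set" where
  "cayley_arcs S = {(a, b). b - a \<in> S}"

definition adj_matrix :: "('v::finite \<times> 'v) set \<Rightarrow> complex ^ 'v ^ 'v" where
  "adj_matrix E = (\<chi> u v. if (u, v) \<in> E then 1 else 0)"

definition herm_adj_matrix :: "('v::finite \<times> 'v) set \<Rightarrow> complex ^ 'v ^ 'v" where
  "herm_adj_matrix E = (\<chi> u v.
     if (u, v) \<in> E \<and> (v, u) \<in> E then 1
     else if (u, v) \<in> E then (1 + \<i> * complex_of_real (sqrt 3)) / 2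
     else if (v, u) \<in> E then (1 - \<i> * complex_of_real (sqrt 3)) / 2
     else 0)"

definition eigenvalue :: "complex ^ 'n ^ 'n \<Rightarrow> complex \<Rightarrow> bool" where
  "eigenvalue A k \<longleftrightarrow> (\<exists>x. x \<noteq> 0 \<and> A *v x = k *s x)"

definition omega3 :: complex where
  "omega3 = (- 1 + \<i> * complex_of_real (sqrt 3)) / 2"

definition eisenstein_ints :: "complex set" where
  "eisenstein_ints = {of_int a + of_int b * omega3 | a b. True}"

definition eisenstein_integral :: "('v::finite \<times> 'v) set \<Rightarrow> bool" where
  "eisenstein_integral E \<longleftrightarrow> (\<forall>k. eigenvalue (adj_matrix E) k \<longrightarrow> k \<in> eisenstein_ints)"

definition HS_integral :: "('v::finite \<times> 'v) set \<Rightarrow> bool" where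
  "HS_integral E \<longleftrightarrow> (\<forall>k. eigenvalue (herm_adj_matrix E) k \<longrightarrow> k \<in> \<int>)"

end

theory Submission
  imports Defs "HOL-Computational_Algebra.Fundamental_Theorem_Algebra" "HOL-Number_Theory.Cong"
begin

text \<open>
  Let \<open>A\<close> be the adjacency matrix of the Cayley graph. The Hermitian adjacency matrix is
  \<open>H = (1 + \<omega>) A - \<omega> A\<^sup>T\<close>, and \<open>A\<close> commutes with \<open>A\<^sup>T\<close> because the group is abelian, so
  eigenvectors may be chosen common to \<open>A\<close>, \<open>A\<^sup>T\<close> and \<open>H\<close>, with eigenvalues \<open>\<lambda>\<close>, \<open>cnj \<lambda>\<close> and
  \<open>(1 + \<omega>) \<lambda> - \<omega> cnj \<lambda>\<close>. The last number is an integer if \<open>\<lambda>\<close> is an Eisenstein integer.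
  Conversely, applying this to \<open>\<lambda>\<close> and \<open>cnj \<lambda>\<close> yields integers \<open>m\<close>, \<open>n\<close> with
  \<open>(n - m)\<^sup>2 = - 3 (\<lambda> - cnj \<lambda>)\<^sup>2\<close>. As \<open>(\<lambda> - cnj \<lambda>)\<^sup>2\<close> is an eigenvalue of the integer
  matrix \<open>(A - A\<^sup>T)\<^sup>2\<close>, a determinant modulo 3 shows that 3 divides \<open>n - m\<close>, and then
  \<open>\<lambda> = m + 2 b + b \<omega>\<close> with \<open>b = (n - m) / 3\<close>.
\<close>

text \<open>Products with \<open>transpose A\<close> stay in the form
  \<open>transpose A *v x\<close>, so that \<open>A\<close> and its transpose are treated
  alike.\<close>

declare transpose_matrix_vector [simp del]

section \<open>Common eigenvectors of commuting matrices\<close>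

definition poly_act :: "complex poly \<Rightarrow> complex ^ 'n ^ 'n \<Rightarrow> complex ^ 'n \<Rightarrow> complex ^ 'n" where
  "poly_act p A x = (\<Sum>i\<le>degree p. coeff p i *s (((*v) A ^^ i) x))"

lemma poly_act_altdef:
  assumes "degree p \<le> n"
  shows "poly_act p A x = (\<Sum>i\<le>n. coeff p i *s (((*v) A ^^ i) x))"
  unfolding poly_act_def
  by (rule sum.mono_neutral_left) (use assms in \<open>auto simp: coeff_eq_0\<close>)

lemma matrix_power_vec_diff:
  fixes A :: "complex ^ 'n ^ 'n"
  shows "((*v) A ^^ i) (A *v x - c *s x) = ((*v) A ^^ Suc i) x - c *s ((*v) A ^^ i) x"
proof (induction i)
  case (Suc i)
  then show ?case
    by (simp add: matrix_vector_mult_diff_distrib matrix_vector_mult_scaleR vector_scalar_commute)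
qed simp

text \<open>Peels off one root: (X - c) q evaluated at \<open>A\<close> first applies A - c and then
  q. The two sums arise from multiplying \<open>q\<close> by X and by c.\<close>

lemma poly_act_linear_factor:
  fixes A :: "complex ^ 'n ^ 'n"
  shows "poly_act ([:-c, 1:] * q) A x = poly_act q A (A *v x - c *s x)"
proof -
  define n where "n = degree q"
  define f where "f i = ((*v) A ^^ i) x" for i
  have deg: "degree ([:-c, 1:] * q) \<le> Suc n"
    using degree_mult_le[of "[:-c, 1:]" q] by (simp add: n_def)
  have co: "coeff ([:-c, 1:] * q) i = coeff (pCons 0 q) i - c * coeff q i" for i
    by (simp add: mult_pCons_left)
  have "poly_act ([:-c, 1:] * q) A x
      = (\<Sum>i\<le>Suc n. coeff (pCons 0 q) i *s f i) - (\<Sum>i\<le>Suc n. (c * coeff q i) *s f i)"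
    unfolding poly_act_altdef[OF deg] co f_def
    by (simp only: vector_sub_rdistrib sum_subtractf)
  also have "(\<Sum>i\<le>Suc n. coeff (pCons 0 q) i *s f i) = (\<Sum>i\<le>n. coeff q i *s f (Suc i))"
    by (subst sum.atMost_Suc_shift) simp
  also have "(\<Sum>i\<le>Suc n. (c * coeff q i) *s f i) = (\<Sum>i\<le>n. (c * coeff q i) *s f i)"
    by (simp add: n_def coeff_eq_0)
  also have "(\<Sum>i\<le>n. coeff q i *s f (Suc i)) - (\<Sum>i\<le>n. (c * coeff q i) *s f i)
      = (\<Sum>i\<le>n. coeff q i *s (f (Suc i) - c *s f i))"
    by (simp add: sum_subtractf[symmetric] vector_ssub_ldistrib vector_smult_assoc mult.commute)
  also have "\<dots> = poly_act q A (A *v x - c *s x)"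
    unfolding poly_act_def n_def f_def matrix_power_vec_diff ..
  finally show ?thesis .
qed

lemma exists_annihilating_poly:
  fixes A :: "complex ^ 'n ^ 'n"
  shows "\<exists>p. p \<noteq> 0 \<and> poly_act p A x = 0"
proof -
  define n where "n = CARD('n)"
  define f where "f i = ((*v) A ^^ i) x" for i
  have "\<exists>u. (\<exists>i\<le>n. u i \<noteq> 0) \<and> (\<Sum>i\<le>n. u i *s f i) = 0"
  \<comment> \<open>Linear dependence is a property of a set of vectors, so coinciding iterates need
    their own case; there X^i - X^j annihilates \<open>x\<close>. Otherwise n + 1 distinct vectors
    in dimension n are dependent.\<close>
  proof (cases "inj_on f {..n}")
    case False
    then obtain i j where ij: "i \<le> n" "j \<le> n" "i \<noteq> j" "f i = f j"
      by (auto simp: inj_on_def)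
    define u :: "nat \<Rightarrow> complex" where "u k = (if k = i then 1 else if k = j then -1 else 0)" for k
    have "(\<Sum>k\<le>n. u k *s f k) = (\<Sum>k\<in>{i, j}. u k *s f k)"
      by (rule sum.mono_neutral_right) (use ij in \<open>auto simp: u_def\<close>)
    also have "\<dots> = 0"
      using ij by (simp add: u_def)
    finally have "(\<Sum>k\<le>n. u k *s f k) = 0" .
    moreover have "u i \<noteq> 0"
      by (simp add: u_def)
    ultimately show ?thesis
      using ij by blast
  next
    case True
    have "vec.dependent (f ` {..n})"
    proof (rule ccontr)
      assume "\<not> vec.dependent (f ` {..n})"
      then have "card (f ` {..n}) \<le> vec.dim (UNIV :: (complex ^ 'n) set)"
        by (intro vec.independent_card_le_dim) auto
      then show False
        using True by (simp add: card_image n_def vec.dim_UNIV card_cart_basis)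
    qed
    then obtain u where u: "\<exists>v\<in>f ` {..n}. u v \<noteq> 0" "(\<Sum>v\<in>f ` {..n}. u v *s v) = 0"
      using vec.dependent_finite[of "f ` {..n}"] by auto
    have "(\<Sum>i\<le>n. (u \<circ> f) i *s f i) = 0"
      using u(2) True by (simp add: sum.reindex)
    moreover have "\<exists>i\<le>n. (u \<circ> f) i \<noteq> 0"
      using u(1) by auto
    ultimately show ?thesis
      by blast
  qed
  then obtain u i where u: "i \<le> n" "u i \<noteq> 0" "(\<Sum>i\<le>n. u i *s f i) = 0"
    by blast
  define p where "p = (\<Sum>i\<le>n. monom (u i) i)"
  have co: "coeff p i = (if i \<le> n then u i else 0)" for i
    by (simp add: p_def coeff_sum)
  have "degree p \<le> n"
    by (rule degree_le) (simp add: co)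
  then have "poly_act p A x = (\<Sum>i\<le>n. u i *s f i)"
    by (simp add: poly_act_altdef co f_def)
  moreover have "p \<noteq> 0"
    using co[of i] u by auto
  ultimately show ?thesis
    using u by auto
qed

text \<open>Take a root c of \<open>p\<close>. Either \<open>x\<close> is an eigenvector for c, or
  (A - c) x is a nonzero element of \<open>V\<close> annihilated by the quotient, which has smaller
  degree.\<close>

lemma eigenvector_in_invariant_set:
  fixes A :: "complex ^ 'n ^ 'n"
  assumes "p \<noteq> 0" "poly_act p A x = 0" "x \<noteq> 0" "x \<in> V"
    and inv: "\<And>c y. y \<in> V \<Longrightarrow> A *v y - c *s y \<in> V"
  shows "\<exists>y l. y \<in> V \<and> y \<noteq> 0 \<and> A *v y = l *s y"
  using assms(1-4)
proof (induction "degree p" arbitrary: p x)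
  case 0
  then obtain c where "p = [:c:]" "c \<noteq> 0"
    using degree_eq_zeroE by (metis pCons_0_0)
  with 0 show ?case
    by (simp add: poly_act_def)
next
  case (Suc n)
  then obtain c where "poly p c = 0"
    using fundamental_theorem_of_algebra constant_degree by (metis nat.distinct(1))
  then obtain q where q: "p = [:-c, 1:] * q"
    by (auto simp: poly_eq_0_iff_dvd)
  show ?case
  proof (cases "A *v x - c *s x = 0")
    case True
    with Suc.prems show ?thesis
      by auto
  next
    case False
    have "q \<noteq> 0"
      using q Suc.prems by auto
    then have "n = degree q"
      using Suc.hyps(2) by (simp add: q degree_mult_eq del: mult_pCons_left)
    moreover have "poly_act q A (A *v x - c *s x) = 0"
      using Suc.prems(2) unfolding q poly_act_linear_factor .
    ultimately show ?thesis
      using Suc.hyps(1) \<open>q \<noteq> 0\<close> False inv Suc.prems by blast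
  qed
qed

text \<open>The eigenspace of \<open>A\<close> for \<open>k\<close> is preserved by
  \<open>B\<close>, hence contains an eigenvector of \<open>B\<close>.\<close>

lemma commuting_common_eigenvector:
  fixes A B :: "complex ^ 'n ^ 'n"
  assumes "eigenvalue A k" and comm: "\<And>x. A *v (B *v x) = B *v (A *v x)"
  obtains x l where "x \<noteq> 0" "A *v x = k *s x" "B *v x = l *s x"
proof -
  obtain x where x: "x \<noteq> 0" "A *v x = k *s x"
    using assms(1) by (auto simp: eigenvalue_def)
  obtain p where p: "p \<noteq> 0" "poly_act p B x = 0"
    using exists_annihilating_poly by blast
  have "B *v y - c *s y \<in> {y. A *v y = k *s y}" if "y \<in> {y. A *v y = k *s y}" for c y
    using that
    by (simp add: matrix_vector_mult_diff_distrib vector_scalar_commute comm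
        vector_ssub_ldistrib vector_smult_assoc mult.commute)
  from eigenvector_in_invariant_set[OF p x(1), of "{y. A *v y = k *s y}", OF _ this] x(2)
  show ?thesis
    using that by auto
qed

section \<open>Conjugation and transposition of real matrices\<close>

definition vec_cnj :: "complex ^ 'n \<Rightarrow> complex ^ 'n" where
  "vec_cnj x = (\<chi> i. cnj (x $ i))"

lemma vec_cnj_eq_0_iff [simp]: "vec_cnj x = 0 \<longleftrightarrow> x = 0"
  by (simp add: vec_cnj_def vec_eq_iff)

lemma vec_cnj_smult: "vec_cnj (c *s x) = cnj c *s vec_cnj x"
  by (simp add: vec_cnj_def vec_eq_iff)

lemma real_matrix_mult_vec_cnj:
  assumes "\<And>i j. cnj (A $ i $ j) = A $ i $ j"
  shows "A *v vec_cnj x = vec_cnj (A *v x)"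
  using assms by (simp add: vec_cnj_def vec_eq_iff matrix_vector_mult_def)

text \<open>The transpose of a real matrix is its adjoint, so evaluating the inner product of
  \<open>transpose A *v x\<close> with \<open>x\<close> in two ways gives k N = cnj l N, where N > 0
  is the squared norm of \<open>x\<close>.\<close>

lemma transpose_eigenvalue_eq_cnj:
  fixes A :: "complex ^ 'n ^ 'n"
  assumes real: "\<And>i j. cnj (A $ i $ j) = A $ i $ j"
    and "x \<noteq> 0" and A: "A *v x = l *s x" and At: "transpose A *v x = k *s x"
  shows "k = cnj l"
proof -
  define N where "N = (\<Sum>i\<in>UNIV. x $ i * cnj (x $ i))"
  have "N = of_real (\<Sum>i\<in>UNIV. (cmod (x $ i))\<^sup>2)"
    by (simp add: N_def complex_norm_square del: of_real_power)
  moreover have "(\<Sum>i\<in>UNIV. (cmod (x $ i))\<^sup>2) \<noteq> 0"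
    using \<open>x \<noteq> 0\<close> by (subst sum_nonneg_eq_0_iff) (auto simp: vec_eq_iff)
  ultimately have "N \<noteq> 0"
    by (metis of_real_eq_0_iff)
  have "k * N = (\<Sum>i\<in>UNIV. (transpose A *v x) $ i * cnj (x $ i))"
    by (simp add: At N_def sum_distrib_left mult.assoc)
  also have "\<dots> = (\<Sum>i\<in>UNIV. \<Sum>j\<in>UNIV. A $ j $ i * x $ j * cnj (x $ i))"
    by (simp add: matrix_vector_mult_def transpose_def sum_distrib_right)
  also have "\<dots> = (\<Sum>j\<in>UNIV. \<Sum>i\<in>UNIV. A $ j $ i * x $ j * cnj (x $ i))"
    by (rule sum.swap)
  also have "\<dots> = (\<Sum>j\<in>UNIV. x $ j * cnj ((A *v x) $ j))"
    by (simp add: matrix_vector_mult_def sum_distrib_left real mult_ac)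
  also have "\<dots> = cnj l * N"
    by (simp add: A N_def sum_distrib_left mult_ac)
  finally show ?thesis
    using \<open>N \<noteq> 0\<close> by simp
qed

section \<open>Eigenvalues of integer matrices and divisibility\<close>

lemma det_cong:
  fixes A B :: "int ^ 'n ^ 'n"
  assumes "\<And>i j. [A $ i $ j = B $ i $ j] (mod q)"
  shows "[det A = det B] (mod q)"
  unfolding det_def by (intro cong_sum cong_mult cong_prod cong_refl assms)

lemma of_int_det:
  fixes A :: "int ^ 'n ^ 'n"
  shows "of_int (det A) = det (\<chi> i j. (of_int (A $ i $ j) :: 'a::comm_ring_1))"
  by (simp add: det_def)

text \<open>The matrix M = k I - q C is singular, and modulo q its determinant is that of D = k I, a
  power of \<open>k\<close>.\<close>

lemma prime_dvd_of_int_matrix_eigenvalue: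
  fixes C :: "int ^ 'n ^ 'n" and x :: "complex ^ 'n"
  assumes "prime q" "x \<noteq> 0"
    and eig: "of_int q *s ((\<chi> i j. of_int (C $ i $ j)) *v x) = of_int k *s x"
  shows "q dvd k"
proof -
  define M :: "int ^ 'n ^ 'n" where "M = (\<chi> i j. (if i = j then k else 0) - q * C $ i $ j)"
  define D :: "int ^ 'n ^ 'n" where "D = (\<chi> i j. if i = j then k else 0)"
  define M' :: "complex ^ 'n ^ 'n" where "M' = (\<chi> i j. of_int (M $ i $ j))"
  have "M' *v x = of_int k *s x - of_int q *s ((\<chi> i j. of_int (C $ i $ j)) *v x)"
  proof (intro vec_eq_iff[THEN iffD2] allI)
    fix i
    have "M' $ i $ j * x $ j
        = (if i = j then of_int k * x $ j else 0) - of_int q * (of_int (C $ i $ j) * x $ j)" for j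
      by (simp add: M'_def M_def algebra_simps)
    then show "(M' *v x) $ i
        = (of_int k *s x - of_int q *s ((\<chi> i j. of_int (C $ i $ j)) *v x)) $ i"
      by (simp add: matrix_vector_mult_def sum_subtractf sum_distrib_left)
  qed
  then have "M' *v x = 0"
    using eig by simp
  then have "\<not> invertible M'"
    using \<open>x \<noteq> 0\<close> unfolding invertible_left_inverse matrix_left_invertible_ker by blast
  then have "of_int (det M) = (0 :: complex)"
    unfolding of_int_det M'_def[symmetric] by (simp add: invertible_det_nz)
  then have "det M = 0"
    by simp
  moreover have "[det M = det D] (mod q)"
    by (rule det_cong) (simp add: M_def D_def cong_iff_dvd_diff)
  moreover have "det D = k ^ CARD('n)"
    by (subst det_diagonal) (simp_all add: D_def)
  ultimately have "q dvd k ^ CARD('n)"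
    by (metis cong_0_iff cong_sym)
  then show ?thesis
    using \<open>prime q\<close> prime_dvd_power by blast
qed

section \<open>Arithmetic of \<omega> and the matrices of the graph\<close>

lemma omega3_sq: "omega3 * omega3 = - 1 - omega3"
proof -
  have "complex_of_real (sqrt 3) * complex_of_real (sqrt 3) = 3"
    by (simp flip: of_real_mult)
  then show ?thesis
    by (simp add: omega3_def field_simps)
qed

lemma omega3_mult_left: "omega3 * (omega3 * z) = - z - omega3 * z"
  by (simp add: omega3_sq left_diff_distrib flip: mult.assoc)

lemma cnj_omega3: "cnj omega3 = - 1 - omega3"
  by (simp add: omega3_def field_simps)

lemma omega3_nonzero: "omega3 \<noteq> 0"
  using omega3_sq by auto

text \<open>A single arc has weight 1 + \<omega>, its reverse has weight -\<omega>, and the two add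
  up to 1 on an undirected edge.\<close>

lemma herm_adj_matrix_mult_vec:
  "herm_adj_matrix E *v x
     = (1 + omega3) *s (adj_matrix E *v x) - omega3 *s (transpose (adj_matrix E) *v x)"
proof -
  have "herm_adj_matrix E $ u $ v
      = (1 + omega3) * adj_matrix E $ u $ v - omega3 * adj_matrix E $ v $ u" for u v
    by (auto simp: herm_adj_matrix_def adj_matrix_def omega3_def field_simps)
  then show ?thesis
    by (simp add: vec_eq_iff matrix_vector_mult_def transpose_def sum_distrib_left
        left_diff_distrib distrib_right sum_subtractf sum.distrib mult.assoc)
qed

lemma adj_matrix_real: "cnj (adj_matrix E $ i $ j) = adj_matrix E $ i $ j"
  by (simp add: adj_matrix_def)

text \<open>The entries count common out-neighbours and common in-neighbours of u and v; the
  involution sending w to u + v - w exchanges the two sets.\<close>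

lemma cayley_adj_matrix_normal:
  fixes S :: "'a::{ab_group_add, finite} set"
  defines "A \<equiv> adj_matrix (cayley_arcs S)"
  shows "A ** transpose A = transpose A ** A"
proof -
  have "(\<Sum>w\<in>UNIV. A $ u $ w * A $ v $ w) = (\<Sum>w\<in>UNIV. A $ w $ u * A $ w $ v)" for u v
    by (rule sum.reindex_bij_witness[of _ "\<lambda>w. u + v - w" "\<lambda>w. u + v - w"])
      (auto simp: A_def adj_matrix_def cayley_arcs_def)
  then show ?thesis
    by (simp add: vec_eq_iff matrix_matrix_mult_def transpose_def)
qed

text \<open>Since 1 + \<omega> = - cnj \<omega>, the number is minus the trace z + cnj z of the
  Eisenstein integer z = \<omega> cnj l.\<close>

lemma eisenstein_trace_in_Ints:
  assumes "l \<in> eisenstein_ints"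
  shows "(1 + omega3) * l - omega3 * cnj l \<in> \<int>"
proof -
  obtain a b :: int where l: "l = of_int a + of_int b * omega3"
    using assms by (auto simp: eisenstein_ints_def)
  have "(1 + omega3) * l - omega3 * cnj l = of_int (a - 2 * b)"
    using omega3_sq by (simp add: l cnj_omega3) algebra
  then show ?thesis
    by simp
qed

theorem theorem5p9:
  fixes S :: "'a::{ab_group_add, finite} set"
  assumes "0 \<notin> S"
  shows "eisenstein_integral (cayley_arcs S) \<longleftrightarrow> HS_integral (cayley_arcs S)"
proof -
  define A where "A = adj_matrix (cayley_arcs S)"
  define H where "H = herm_adj_matrix (cayley_arcs S)"
  have comm: "A *v (transpose A *v x) = transpose A *v (A *v x)" for x
    using cayley_adj_matrix_normal[of S] by (simp add: A_def matrix_vector_mul_assoc)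
  have H: "H *v x = (1 + omega3) *s (A *v x) - omega3 *s (transpose A *v x)" for x
    by (simp add: A_def H_def herm_adj_matrix_mult_vec)
  have real: "cnj (A $ i $ j) = A $ i $ j" for i j
    by (simp add: A_def adj_matrix_real)
  show ?thesis
    unfolding eisenstein_integral_def HS_integral_def A_def[symmetric] H_def[symmetric]
  proof (intro iffI allI impI)
    fix k
    assume eis: "\<forall>k. eigenvalue A k \<longrightarrow> k \<in> eisenstein_ints" and "eigenvalue H k"
    have "H *v (A *v x) = A *v (H *v x)" for x
      by (simp add: H comm matrix_vector_mult_diff_distrib matrix_vector_right_distrib
          vector_scalar_commute)
    from commuting_common_eigenvector[OF \<open>eigenvalue H k\<close> this]
    obtain x l where x: "x \<noteq> 0" "H *v x = k *s x" "A *v x = l *s x" .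
    \<comment> \<open>Solving the formula for \<open>H\<close> for the transpose shows that
      \<open>x\<close> is an eigenvector of \<open>transpose A\<close> as well.\<close>
    have "omega3 *s (transpose A *v x) = ((1 + omega3) * l - k) *s x"
      using H[of x] x by (simp add: vector_sub_rdistrib vector_smult_assoc)
    then have "inverse omega3 *s (omega3 *s (transpose A *v x))
        = inverse omega3 *s (((1 + omega3) * l - k) *s x)"
      by simp
    then have At: "transpose A *v x = (inverse omega3 * ((1 + omega3) * l - k)) *s x"
      by (simp only: vector_smult_assoc left_inverse[OF omega3_nonzero] vector_smult_lid)
    have "inverse omega3 * ((1 + omega3) * l - k) = cnj l"
      by (rule transpose_eigenvalue_eq_cnj[OF real x(1) x(3) At])
    then have "k = (1 + omega3) * l - omega3 * cnj l"
      using omega3_nonzero by (simp add: field_simps)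
    moreover have "l \<in> eisenstein_ints"
      using eis x by (auto simp: eigenvalue_def)
    ultimately show "k \<in> \<int>"
      by (simp add: eisenstein_trace_in_Ints)
  next
    fix l
    assume HS: "\<forall>k. eigenvalue H k \<longrightarrow> k \<in> \<int>" and "eigenvalue A l"
    from commuting_common_eigenvector[OF \<open>eigenvalue A l\<close> comm]
    obtain x k where x: "x \<noteq> 0" "A *v x = l *s x" "transpose A *v x = k *s x" .
    have "k = cnj l"
      by (rule transpose_eigenvalue_eq_cnj[OF real x])
    note At = x(3)[unfolded this]
    have "H *v x = ((1 + omega3) * l - omega3 * cnj l) *s x"
      by (simp add: H x(2) At vector_sub_rdistrib vector_smult_assoc)
    then have "(1 + omega3) * l - omega3 * cnj l \<in> \<int>"
      using HS x(1) unfolding eigenvalue_def by blast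
    then obtain m where m: "(1 + omega3) * l - omega3 * cnj l = of_int m"
      by (auto elim: Ints_cases)
    \<comment> \<open>As \<open>A\<close> is real, conjugating the eigenvector interchanges
      \<open>l\<close> and \<open>cnj l\<close>, which yields a second eigenvalue of
      \<open>H\<close>.\<close>
    have "A *v vec_cnj x = cnj l *s vec_cnj x"
      by (simp add: real_matrix_mult_vec_cnj real x(2) vec_cnj_smult)
    moreover have "transpose A *v vec_cnj x = l *s vec_cnj x"
      by (subst real_matrix_mult_vec_cnj)
        (simp_all add: transpose_def[of A] real At[unfolded transpose_def] vec_cnj_smult)
    ultimately have "H *v vec_cnj x = ((1 + omega3) * cnj l - omega3 * l) *s vec_cnj x"
      by (simp add: H vector_sub_rdistrib vector_smult_assoc)
    then have "(1 + omega3) * cnj l - omega3 * l \<in> \<int>"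
      using HS x(1) vec_cnj_eq_0_iff unfolding eigenvalue_def by blast
    then obtain n where n: "(1 + omega3) * cnj l - omega3 * l = of_int n"
      by (auto elim: Ints_cases)
    \<comment> \<open>Here n - m = -(1 + 2\<omega>) (l - cnj l), and (1 + 2\<omega>) squares to
      -3.\<close>
    have sq: "3 * (l - cnj l)\<^sup>2 = of_int (- (n - m)\<^sup>2)"
    proof -
      have "of_int (n - m) = - (1 + 2 * omega3) * (l - cnj l)"
        using m n by (simp add: algebra_simps flip: m n)
      then show ?thesis
        using omega3_sq by simp algebra
    qed
    \<comment> \<open>The integer form of A - A^T. Its square is used because l - cnj l is purely
      imaginary, whereas three times its square is the integer -(n - m)^2.\<close>
    define Z :: "((int, 'a) vec, 'a) vec"
      where "Z = (\<chi> i j. of_bool ((i, j) \<in> cayley_arcs S) - of_bool ((j, i) \<in> cayley_arcs S))"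
    have Z: "(\<chi> i j. of_int (Z $ i $ j)) = A - transpose A"
      by (simp add: Z_def A_def adj_matrix_def transpose_def vec_eq_iff)
    have "(\<chi> i j. of_int ((Z ** Z) $ i $ j))
        = (\<chi> i j. of_int (Z $ i $ j)) ** (\<chi> i j. (of_int (Z $ i $ j) :: complex))"
      by (simp add: matrix_matrix_mult_def vec_eq_iff)
    then have ZZ: "(\<chi> i j. of_int ((Z ** Z) $ i $ j)) = (A - transpose A) ** (A - transpose A)"
      by (simp only: Z)
    have "(A - transpose A) *v x = (l - cnj l) *s x"
      by (simp add: matrix_vector_mult_diff_rdistrib x(2) At vector_sub_rdistrib)
    then have "(\<chi> i j. of_int ((Z ** Z) $ i $ j)) *v x = (l - cnj l)\<^sup>2 *s x"
      unfolding ZZ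
      by (simp only: matrix_vector_mul_assoc[symmetric] vector_scalar_commute vector_smult_assoc
          power2_eq_square)
    then have "of_int 3 *s ((\<chi> i j. of_int ((Z ** Z) $ i $ j)) *v x) = of_int (- (n - m)\<^sup>2) *s x"
      unfolding sq[symmetric] by (simp only: vector_smult_assoc) simp
    from prime_dvd_of_int_matrix_eigenvalue[OF _ x(1) this]
    have "3 dvd (n - m)\<^sup>2"
      by simp
    then have "3 dvd n - m"
      using prime_dvd_power[of "3 :: int"] by simp
    then obtain b where b: "n - m = 3 * b"
      by (elim dvdE)
    then have "n = m + 3 * b"
      by simp
    with n have n': "(1 + omega3) * cnj l - omega3 * l = of_int m + 3 * of_int b"
      by simp
    have "3 * l = 3 * (of_int (m + 2 * b) + of_int b * omega3)"
    proof -
      \<comment> \<open>Adding 1 + \<omega> times \<open>m\<close> and \<omega> times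
        \<open>n'\<close> eliminates \<open>cnj l\<close>. Multiplying by -(1 + 2\<omega>) then
        turns the factor of \<open>l\<close> into 3.\<close>
      have "(1 + 2 * omega3) * l = (1 + 2 * omega3) * of_int m + 3 * omega3 * of_int b"
        using arg_cong2[OF arg_cong[OF m, of "(*) (1 + omega3)"]
            arg_cong[OF n', of "(*) omega3"], of "(+)"]
        by (simp add: algebra_simps)
      from arg_cong[OF this, of "(*) (- (1 + 2 * omega3))"] show ?thesis
        by (simp add: algebra_simps omega3_sq omega3_mult_left)
    qed
    then have "l = of_int (m + 2 * b) + of_int b * omega3"
      by (simp only: mult_cancel_left) simp
    then show "l \<in> eisenstein_ints"
      unfolding eisenstein_ints_def by blast
  qed
qed

end
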